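(* Let $G$ be a finite simple graph on vertex set $[n]=\{1,\dots,n\}$, let $\boldsymbol{p}=(p_1,\dots,p_n)\in[0,1)^n$, and let $f:\{0,1\}^n\to\mathbb{R}_{\ge0}$. If $f$ is a supermodular function with $f(\emptyset)>0$ that factorizes according to $\boldsymbol{p},G$, and there exist $r_1,\dots,r_n\in[0,1)$ such that $p_i\le r_i\prod_{j\in\Gamma_i}(1-r_j)$ for all $i\in[n]$, then for every $S\subseteq[n]$, $$f(S)\ge f(\emptyset)\prod_{i\in S}(1-r_i)>0.$$
   Context: $\Gamma_i$ denotes the set of neighbors of vertex $i$ in $G$. A function $f:\{0,1\}^n\to\mathbb{R}_{\ge0}$ is also regarded as a function on subsets of $[n]$ by identifying $\boldsymbol{x}\in\{0,1\}^n$ with the set having characteristic vector $\boldsymbol{x}$; thus $f(\emptyset)=f(\boldsymbol{0})$. For $i\in[n]$ and $S\subseteq[n]\setminus\{i\}$, $\Delta_if(S)=f(S\cup\{i\})-f(S)$. $f$ is supermodular if for every $i\in[n]$, $\Delta_if(S)\le\Delta_if(T)$ whenever $S\subseteq T\subseteq[n]\setminus\{i\}$. $f$ factorizes according to $\boldsymbol{p},G$ if $f(S\cup\{i\})\ge(1-p_i)f(S)$ for all $i\in[n]$ and all $S\subseteq[n]\setminus(\Gamma_i\cup\{i\})$. *)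

theory Defs
  imports Complex_Main "HOL-Library.FuncSet" "Graph_Theory.Pair_Digraph"
begin

text \<open>
  A finite simple graph is a \<open>pair_graph\<close>: a finite loop-free digraph whose arc set is a
  symmetric set of pairs, each edge being present in both orientations.
  A function on \<open>{0,1}^n\<close> is a function on subsets of \<open>{1..n}\<close>, a 0/1 vector being
  identified with the set of which it is the characteristic vector.
\<close>

definition neighbors :: "'a pair_pre_digraph \<Rightarrow> 'a \<Rightarrow> 'a set" where
  "neighbors G i = {j. (i, j) \<in> parcs G}"

definition marginal :: "('a set \<Rightarrow> real) \<Rightarrow> 'a \<Rightarrow> 'a set \<Rightarrow> real" where
  "marginal f i S = f (S \<union> {i}) - f S"

definition supermodular_on :: "'a set \<Rightarrow> ('a set \<Rightarrow> real) \<Rightarrow> bool" where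
  "supermodular_on V f \<longleftrightarrow>
     (\<forall>i\<in>V. \<forall>S T. S \<subseteq> T \<and> T \<subseteq> V - {i} \<longrightarrow> marginal f i S \<le> marginal f i T)"

definition factorizes :: "('a \<Rightarrow> real) \<Rightarrow> 'a pair_pre_digraph \<Rightarrow> ('a set \<Rightarrow> real) \<Rightarrow> bool" where
  "factorizes p G f \<longleftrightarrow>
     (\<forall>i\<in>pverts G. \<forall>S. S \<subseteq> pverts G - (neighbors G i \<union> {i}) \<longrightarrow>
        f (S \<union> {i}) \<ge> (1 - p i) * f S)"

end

theory Submission
  imports Defs
begin

text \<open>
  The heart of the proof is the one-step bound \<open>f (S \<union> {i}) \<ge> (1 - r i) * f S\<close>, by strong
  induction on \<open>S\<close>. Let \<open>T = S - neighbors G i\<close>. Supermodularity and factorization bound the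
  marginal of \<open>i\<close> at \<open>S\<close> from below by \<open>- p i * f T\<close>. Adding the vertices of \<open>S - T\<close> to \<open>T\<close> one
  at a time, the induction hypothesis gives \<open>f T * (\<Prod>j\<in>S - T. 1 - r j) \<le> f S\<close>, so the
  hypothesis on \<open>p i\<close> yields \<open>p i * f T \<le> r i * f S\<close>.
\<close>

text \<open>The bound \<open>step\<close> is only required inside the ambient set \<open>S\<close>.
  This lets the lemma serve both within the induction, where the one-step bound is known only below
  the current set, and at the end with all of \<open>{1..n}\<close>.\<close>

lemma union_ge_prod_of_step:
  fixes f :: "'a set \<Rightarrow> real"
  assumes step: "\<And>T a. a \<notin> T \<Longrightarrow> insert a T \<subseteq> S \<Longrightarrow> (1 - r a) * f T \<le> f (insert a T)"
    and r: "\<And>a. a \<in> S \<Longrightarrow> r a \<le> 1"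
    and "finite A" "B \<union> A \<subseteq> S" "B \<inter> A = {}"
  shows "f B * (\<Prod>a\<in>A. 1 - r a) \<le> f (B \<union> A)"
  using \<open>finite A\<close> \<open>B \<union> A \<subseteq> S\<close> \<open>B \<inter> A = {}\<close>
proof (induction A rule: finite_induct)
  case empty
  then show ?case by simp
next
  case (insert a A)
  have "f B * (\<Prod>b\<in>insert a A. 1 - r b) = (1 - r a) * (f B * (\<Prod>b\<in>A. 1 - r b))"
    using insert.hyps by simp
  also have "\<dots> \<le> (1 - r a) * f (B \<union> A)"
    using insert r[of a] by (intro mult_left_mono) auto
  also have "\<dots> \<le> f (insert a (B \<union> A))"
    using insert by (intro step) auto
  finally show ?case by simp
qed

lemma (in pair_graph) factorizes_step:
  fixes f :: "'a set \<Rightarrow> real"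
  assumes nonneg: "\<And>T. T \<subseteq> pverts G \<Longrightarrow> 0 \<le> f T"
    and super: "supermodular_on (pverts G) f"
    and fact: "factorizes p G f"
    and r: "\<And>j. j \<in> pverts G \<Longrightarrow> 0 \<le> r j \<and> r j \<le> 1"
    and p: "\<And>j. j \<in> pverts G \<Longrightarrow> p j \<le> r j * (\<Prod>k\<in>neighbors G j. 1 - r k)"
    and S: "i \<notin> S" "insert i S \<subseteq> pverts G"
  shows "(1 - r i) * f S \<le> f (insert i S)"
proof -
  have "finite S"
    using S finite_subset[OF _ pair_finite_verts] by auto
  then show ?thesis
    using S
  \<comment> \<open>The vertex is generalized because the induction hypothesis is applied to
    elements of \<open>S\<close>, whereas \<open>i\<close> lies outside \<open>S\<close>.\<close>
  proof (induction S arbitrary: i rule: finite_psubset_induct)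
    case (psubset S)
    define N where "N = neighbors G i"
    define T where "T = S - N"
    have i: "i \<in> pverts G" and SV: "S \<subseteq> pverts G"
      using psubset.prems by auto
    have N: "N \<subseteq> pverts G"
      unfolding N_def neighbors_def by (auto dest: in_arcsD2)
    have T: "T \<subseteq> S"
      by (auto simp: T_def)
    have fT: "0 \<le> f T"
      using nonneg T SV by auto
    have chain: "f T * (\<Prod>a\<in>S \<inter> N. 1 - r a) \<le> f (T \<union> (S \<inter> N))"
    proof (rule union_ge_prod_of_step[where S = S])
      \<comment> \<open>Since \<open>a\<close> lies in \<open>S\<close> but not in \<open>U\<close>,
        the set \<open>U\<close> is a proper subset of \<open>S\<close>.\<close>
      show "(1 - r a) * f U \<le> f (insert a U)" if "a \<notin> U" "insert a U \<subseteq> S" for U a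
        using that SV by (intro psubset.IH) auto
    qed (use r SV psubset.hyps in \<open>auto simp: T_def\<close>)
    have "p i * f T \<le> r i * (\<Prod>j\<in>N. 1 - r j) * f T"
      using p[OF i] fT by (intro mult_right_mono) (auto simp: N_def)
    \<comment> \<open>The neighbors of \<open>i\<close> outside \<open>S\<close> contribute factors
      in [0,1], so dropping them can only increase the product.\<close>
    also have "\<dots> \<le> r i * (\<Prod>j\<in>S \<inter> N. 1 - r j) * f T"
    proof (intro mult_right_mono mult_left_mono fT)
      have "(\<Prod>j\<in>N. 1 - r j) = (\<Prod>j\<in>S \<inter> N. 1 - r j) * (\<Prod>j\<in>N - S. 1 - r j)"
        using prod.Int_Diff[of N "\<lambda>j. 1 - r j" S] N pair_finite_verts
        by (simp add: Int_commute finite_subset)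
      also have "\<dots> \<le> (\<Prod>j\<in>S \<inter> N. 1 - r j) * 1"
        using r N by (intro mult_left_mono prod_le_1 prod_nonneg) auto
      finally show "(\<Prod>j\<in>N. 1 - r j) \<le> (\<Prod>j\<in>S \<inter> N. 1 - r j)" by simp
    qed (use r i in auto)
    also have "\<dots> = r i * (f T * (\<Prod>j\<in>S \<inter> N. 1 - r j))"
      by simp
    also have "\<dots> \<le> r i * f (T \<union> (S \<inter> N))"
      using chain r i by (intro mult_left_mono) auto
    also have "T \<union> (S \<inter> N) = S"
      by (auto simp: T_def)
    finally have pr: "p i * f T \<le> r i * f S" .
    have "marginal f i T \<le> marginal f i S"
      using super i T SV psubset.prems unfolding supermodular_on_def by blast
    moreover have "T \<subseteq> pverts G - (neighbors G i \<union> {i})"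
      using SV psubset.prems by (auto simp: T_def N_def)
    then have "(1 - p i) * f T \<le> f (T \<union> {i})"
      using fact i unfolding factorizes_def by blast
    \<comment> \<open>In total, \<open>f (insert i S) - f S\<close> \<ge>
      \<open>f (T \<union> {i}) - f T\<close> \<ge> \<open>- p i * f T\<close> \<ge>
      \<open>- r i * f S\<close>.\<close>
    ultimately show ?case
      using pr by (simp add: marginal_def algebra_simps)
  qed
qed

theorem corollary2:
  fixes n :: nat and G :: "nat pair_pre_digraph"
    and p r :: "nat \<Rightarrow> real" and f :: "nat set \<Rightarrow> real" and S :: "nat set"
  assumes "pair_graph G" and "pverts G = {1..n}"
    and "p \<in> {1..n} \<rightarrow> {0..<1}"
    and "f \<in> Pow {1..n} \<rightarrow> {0..}"
    and "supermodular_on {1..n} f"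
    and "f {} > 0"
    and "factorizes p G f"
    and "r \<in> {1..n} \<rightarrow> {0..<1}"
    and "\<forall>i\<in>{1..n}. p i \<le> r i * (\<Prod>j\<in>neighbors G i. 1 - r j)"
    and "S \<subseteq> {1..n}"
  shows "f S \<ge> f {} * (\<Prod>i\<in>S. 1 - r i) \<and> f {} * (\<Prod>i\<in>S. 1 - r i) > 0"
proof
  interpret pair_graph G by fact
  have r: "0 \<le> r j \<and> r j < 1" if "j \<in> {1..n}" for j
    using assms(8) that by (auto simp: Pi_iff)
  have step: "(1 - r a) * f T \<le> f (insert a T)" if "a \<notin> T" "insert a T \<subseteq> {1..n}" for a T
    by (rule factorizes_step[where p = p]) (use assms r that in \<open>auto simp: Pi_iff less_imp_le\<close>)
  \<comment> \<open>The set \<open>S\<close> is built up from the empty set, each new vertex costing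
    one factor.\<close>
  have "f {} * (\<Prod>i\<in>S. 1 - r i) \<le> f ({} \<union> S)"
    by (rule union_ge_prod_of_step[where S = "{1..n}"])
      (use step r assms(10) finite_subset[OF assms(10)] in \<open>auto simp: less_imp_le\<close>)
  then show "f S \<ge> f {} * (\<Prod>i\<in>S. 1 - r i)" by simp
  have "(\<Prod>i\<in>S. 1 - r i) > 0"
    using r assms(10) by (intro prod_pos) auto
  then show "f {} * (\<Prod>i\<in>S. 1 - r i) > 0"
    using assms(6) by simp
qed

end
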